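(* Consider a nonlinear system affine in the inputs $\mathbf u=[u_1,\dots,u_m]^{\mathsf T}$ whose outputs are affected by an unknown constant time offset $t_d\in\mathbb R$ relative to the inputs: $$\dot{\mathbf x}(s)=\mathbf f_0(\mathbf x(s))+\sum_{i=1}^m\mathbf f_i(\mathbf x(s))\,u_i(s),\qquad \mathbf y(t)=\mathbf h(\mathbf x(t+t_d)).$$ The unknowns are $\mathbf x(t_0+t_d)$ and $t_d$; the known data are the input function $\mathbf u$ and the output $\mathbf y$ over a time interval. If the control inputs $\mathbf u$ are constant in time, or if the observations $\mathbf y$ are constant in time, then the time offset $t_d$ is weakly unobservable.
   Context: $\mathbf x\in\mathbb R^n$ is the state; the vector fields $\mathbf f_0,\dots,\mathbf f_m$, the output function $\mathbf h$ and the inputs are smooth. Given $(\boldsymbol\xi,\tau)\in\mathbb R^n\times\mathbb R$, the corresponding output on the interval $I=[t_0,t_0+T]$ is $\mathbf y(t)=\mathbf h(\mathbf x(t+\tau))$, where $\mathbf x$ is the solution of the differential equation (with the known inputs $\mathbf u$) satisfying $\mathbf x(t_0+\tau)=\boldsymbol\xi$. Two pairs are indistinguishable if they produce the same output on $I$ for the given input. The time offset is weakly observable at $(\boldsymbol\xi,t_d)$ if there is a neighborhood of $(\boldsymbol\xi,t_d)$ in which every pair $(\boldsymbol\xi',t_d')$ with $t_d'\neq t_d$ can be distinguished from $(\boldsymbol\xi,t_d)$; otherwise it is weakly unobservable. "Constant in time" for the inputs means that $\mathbf u(s)$ does not depend on $s$; for the observations it means that $\mathbf y(t)=\mathbf h(\mathbf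 x(t+t_d))$ does not depend on $t$ (on an open interval containing $I$). *)

theory Defs
  imports "HOL-Analysis.Analysis"
begin

(* C-infinity maps: Ck k f says that all iterated directional derivatives of f
   up to order k exist (as Frechet derivatives) and are continuous. *)
primrec Ck :: "nat \<Rightarrow> ('a::real_normed_vector \<Rightarrow> 'b::real_normed_vector) \<Rightarrow> bool" where
  "Ck 0 f \<longleftrightarrow> continuous_on UNIV f"
| "Ck (Suc k) f \<longleftrightarrow>
     f differentiable_on UNIV \<and> (\<forall>v. Ck k (\<lambda>x. frechet_derivative f (at x) v))"

definition smooth :: "('a::real_normed_vector \<Rightarrow> 'b::real_normed_vector) \<Rightarrow> bool" where
  "smooth f \<longleftrightarrow> (\<forall>k. Ck k f)"

definition control_affine ::
  "('a::real_vector \<Rightarrow> 'a) \<Rightarrow> ('m::finite \<Rightarrow> 'a \<Rightarrow> 'a) \<Rightarrow> (real \<Rightarrow> real ^ 'm) \<Rightarrow> real \<Rightarrow> 'a \<Rightarrow> 'a"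
where
  "control_affine f\<^sub>0 f u s x = f\<^sub>0 x + (\<Sum>i\<in>UNIV. u s $ i *\<^sub>R f i x)"

(* At an endpoint belonging to the interval S the derivative is one-sided. *)
definition solves_ode_on ::
  "(real \<Rightarrow> 'a \<Rightarrow> 'a) \<Rightarrow> real set \<Rightarrow> (real \<Rightarrow> 'a::real_normed_vector) \<Rightarrow> bool" where
  "solves_ode_on F S x \<longleftrightarrow>
     (\<forall>s\<in>S. (x has_vector_derivative F s (x s)) (at s within S))"

(* Relational because a solution through the given point need not exist on all of
   the time window; only the values of y on {t0..t0 + T} matter. *)
definition produces_output ::
  "(real \<Rightarrow> 'a::real_normed_vector \<Rightarrow> 'a) \<Rightarrow> ('a \<Rightarrow> 'b) \<Rightarrow> real \<Rightarrow> real \<Rightarrow> 'a \<times> real \<Rightarrow>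
     (real \<Rightarrow> 'b) \<Rightarrow> bool"
where
  "produces_output F h t0 T p y \<longleftrightarrow>
     (case p of (\<xi>, \<tau>) \<Rightarrow>
       \<exists>x. solves_ode_on F {t0 + \<tau>..t0 + T + \<tau>} x \<and> x (t0 + \<tau>) = \<xi> \<and>
           (\<forall>t\<in>{t0..t0 + T}. y t = h (x (t + \<tau>))))"

(* Both outputs must exist. The universal quantifier makes no use of uniqueness of
   solutions, and with uniqueness it says that the output of p is the output of q. *)
definition indistinguishable ::
  "(real \<Rightarrow> 'a::real_normed_vector \<Rightarrow> 'a) \<Rightarrow> ('a \<Rightarrow> 'b) \<Rightarrow> real \<Rightarrow> real \<Rightarrow>
     'a \<times> real \<Rightarrow> 'a \<times> real \<Rightarrow> bool"
where
  "indistinguishable F h t0 T p q \<longleftrightarrow>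
     (\<exists>y. produces_output F h t0 T p y) \<and> (\<exists>z. produces_output F h t0 T q z) \<and>
     (\<forall>y z. produces_output F h t0 T p y \<longrightarrow> produces_output F h t0 T q z \<longrightarrow>
        (\<forall>t\<in>{t0..t0 + T}. y t = z t))"

definition offset_weakly_observable ::
  "(real \<Rightarrow> 'a::real_normed_vector \<Rightarrow> 'a) \<Rightarrow> ('a \<Rightarrow> 'b) \<Rightarrow> real \<Rightarrow> real \<Rightarrow> 'a \<Rightarrow> real \<Rightarrow> bool"
where
  "offset_weakly_observable F h t0 T \<xi> td \<longleftrightarrow>
     (\<exists>N. open N \<and> (\<xi>, td) \<in> N \<and>
        (\<forall>\<xi>' td'. (\<xi>', td') \<in> N \<and> td' \<noteq> td \<longrightarrow>
           \<not> indistinguishable F h t0 T (\<xi>', td') (\<xi>, td)))"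

definition offset_weakly_unobservable ::
  "(real \<Rightarrow> 'a::real_normed_vector \<Rightarrow> 'a) \<Rightarrow> ('a \<Rightarrow> 'b) \<Rightarrow> real \<Rightarrow> real \<Rightarrow> 'a \<Rightarrow> real \<Rightarrow> bool"
where
  "offset_weakly_unobservable F h t0 T \<xi> td \<longleftrightarrow> \<not> offset_weakly_observable F h t0 T \<xi> td"

definition constant_observations ::
  "(real \<Rightarrow> 'a::real_normed_vector \<Rightarrow> 'a) \<Rightarrow> ('a \<Rightarrow> 'b) \<Rightarrow> real \<Rightarrow> real \<Rightarrow> 'a \<Rightarrow> real \<Rightarrow> bool"
where
  "constant_observations F h t0 T \<xi> td \<longleftrightarrow>
     (\<exists>J x. open J \<and> is_interval J \<and> {t0..t0 + T} \<subseteq> J \<and>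
        solves_ode_on F ((\<lambda>t. t + td) ` J) x \<and> x (t0 + td) = \<xi> \<and>
        (\<lambda>t. h (x (t + td))) constant_on J)"

end

theory Submission
  imports Defs
begin

text \<open>For constant inputs the system is autonomous, so \<open>(\<xi>, \<tau>)\<close> gives the same output for every
  \<open>\<tau>\<close>. For constant observations one moves along the trajectory instead: the pairs
  \<open>(x (t0 + \<tau>), \<tau>)\<close> with \<open>\<tau>\<close> near \<open>td\<close> all give the same constant output. Indistinguishability
  quantifies over all outputs of a pair, so both cases rest on forward uniqueness of
  solutions (Gronwall).\<close>

section \<open>Local Lipschitz bounds and forward uniqueness of trajectories\<close>

lemma smooth_imp_lipschitz_on_cball:
  fixes f :: "'a::euclidean_space \<Rightarrow> 'b::real_normed_vector"
  assumes "smooth f"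
  obtains L where "\<And>x y. x \<in> cball 0 R \<Longrightarrow> y \<in> cball 0 R \<Longrightarrow> norm (f x - f y) \<le> L * norm (x - y)"
proof -
  let ?D = "\<lambda>x. frechet_derivative f (at x)"
  have "Ck (Suc 0) f"
    using assms by (simp only: smooth_def)
  then have diff: "\<And>x. f differentiable at x" and cont: "\<And>v. continuous_on UNIV (\<lambda>x. ?D x v)"
    by (auto simp: differentiable_on_def)
  \<comment> \<open>\<open>Ck\<close> gives continuity of the derivative only in one fixed direction
    at a time, so compactness yields a bound that still depends on \<open>v\<close>.\<close>
  have "\<exists>C. \<forall>x\<in>cball 0 R. norm (?D x v) \<le> C" for v
  proof -
    have "compact ((\<lambda>x. ?D x v) ` cball 0 R)"
      by (intro compact_continuous_image compact_cball continuous_on_subset[OF cont]) simp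
    from compact_imp_bounded[OF this] show ?thesis
      by (simp add: bounded_iff)
  qed
  then obtain C where C: "\<And>v x. x \<in> cball 0 R \<Longrightarrow> norm (?D x v) \<le> C v"
    by metis
  have deriv: "(f has_derivative ?D x) (at x)" for x
    using diff frechet_derivative_works by blast
  \<comment> \<open>By linearity the bounds in the finitely many basis directions control every
    direction. The resulting operator norm bound is the Lipschitz constant in the mean value
    inequality on the convex ball.\<close>
  have "onorm (?D x) \<le> (\<Sum>b\<in>Basis. C b)" if x: "x \<in> cball 0 R" for x
  proof (rule onorm_le)
    fix v :: 'a
    interpret linear "?D x"
      using deriv has_derivative_linear by blast
    have "norm (?D x v) = norm (\<Sum>b\<in>Basis. (v \<bullet> b) *\<^sub>R ?D x b)"
      by (subst euclidean_representation[of v, symmetric]) (simp only: sum scale)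
    also have "\<dots> \<le> (\<Sum>b\<in>Basis. \<bar>v \<bullet> b\<bar> * norm (?D x b))"
      by (rule order_trans[OF norm_sum]) simp
    also have "\<dots> \<le> (\<Sum>b\<in>Basis. norm v * C b)"
      by (intro sum_mono mult_mono Basis_le_norm C x) auto
    finally show "norm (?D x v) \<le> (\<Sum>b\<in>Basis. C b) * norm v"
      by (simp add: sum_distrib_left mult.commute)
  qed
  then show thesis
    using differentiable_bound[OF convex_cball has_derivative_at_withinI[OF deriv]] that by blast
qed

lemma solves_ode_on_imp_continuous_on:
  "solves_ode_on F S x \<Longrightarrow> continuous_on S x"
  unfolding solves_ode_on_def by (rule continuous_on_vector_derivative) blast

text \<open>Gronwall in differential form: the squared distance of the trajectories, damped by an
  exponential, cannot increase and starts at 0. The Lipschitz estimate is asked for only along the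
  two given trajectories, so that a local bound can supply it.\<close>

lemma solves_ode_on_unique:
  fixes x y :: "real \<Rightarrow> 'a::real_inner"
  assumes x: "solves_ode_on F {a..b} x" and y: "solves_ode_on F {a..b} y"
    and init: "x a = y a"
    and lip: "\<And>s. s \<in> {a..b} \<Longrightarrow> norm (F s (x s) - F s (y s)) \<le> L * norm (x s - y s)"
    and s: "s \<in> {a..b}"
  shows "x s = y s"
proof -
  let ?w = "\<lambda>r. x r - y r"
  let ?w' = "\<lambda>r. F r (x r) - F r (y r)"
  \<comment> \<open>The derivative of the squared norm is at most \<open>2 * L\<close> times the
    squared norm; the rate of the exponential is chosen to cancel exactly this growth.\<close>
  let ?e = "\<lambda>r. (?w r \<bullet> ?w r) * exp (- 2 * L * r)"
  have w: "(?w has_vector_derivative ?w' r) (at r within {a..b})" if "r \<in> {a..b}" for r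
    using x y that unfolding solves_ode_on_def by (blast intro: has_vector_derivative_diff)
  have "continuous_on {a..s} x" "continuous_on {a..s} y"
    using x y s by (auto intro!: continuous_on_subset[OF solves_ode_on_imp_continuous_on])
  then have cont: "continuous_on {a..s} ?e"
    by (intro continuous_intros)
  have "?e s \<le> ?e a"
  proof (rule DERIV_nonpos_imp_decreasing_open[OF _ _ cont])
    fix r assume r: "a < r" "r < s"
    \<comment> \<open>At interior points the derivative within the interval is two-sided; at the
      endpoints continuity of \<open>?e\<close> is enough.\<close>
    then have r': "r \<in> {a..b}" "at r within {a..b} = at r"
      using s by (auto simp: at_within_Icc_at)
    have "(?w has_derivative (\<lambda>h. h *\<^sub>R ?w' r)) (at r)"
      using w[OF r'(1)] r'(2) by (simp add: has_vector_derivative_def)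
    note has_derivative_inner[OF this this]
    then have "((\<lambda>r. ?w r \<bullet> ?w r) has_real_derivative 2 * (?w r \<bullet> ?w' r)) (at r)"
      unfolding has_field_derivative_def
      by (rule has_derivative_eq_rhs) (auto simp: inner_commute algebra_simps)
    moreover have "((\<lambda>r. exp (- 2 * L * r)) has_real_derivative exp (- 2 * L * r) * (- 2 * L)) (at r)"
      by (auto intro!: derivative_eq_intros)
    ultimately have "(?e has_real_derivative
        2 * (?w r \<bullet> ?w' r - L * (?w r \<bullet> ?w r)) * exp (- 2 * L * r)) (at r)"
      by (rule DERIV_cong[OF DERIV_mult]) (simp add: algebra_simps)
    moreover have "?w r \<bullet> ?w' r \<le> L * (?w r \<bullet> ?w r)"
    proof -
      have "?w r \<bullet> ?w' r \<le> norm (?w r) * norm (?w' r)"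
        by (rule norm_cauchy_schwarz)
      also have "\<dots> \<le> norm (?w r) * (L * norm (?w r))"
        by (intro mult_left_mono lip r') auto
      finally show ?thesis
        by (simp add: dot_square_norm power2_eq_square mult_ac)
    qed
    then have "2 * (?w r \<bullet> ?w' r - L * (?w r \<bullet> ?w r)) * exp (- 2 * L * r) \<le> 0"
      by (simp add: mult_nonpos_nonneg)
    ultimately show "\<exists>d. (?e has_real_derivative d) (at r) \<and> d \<le> 0"
      by blast
  qed (use s in auto)
  also have "?e a = 0"
    using init by simp
  finally have "?w s \<bullet> ?w s \<le> 0"
    by (simp add: mult_le_0_iff)
  then show ?thesis
    by (metis inner_gt_zero_iff linorder_not_less right_minus_eq)
qed

text \<open>Both trajectories are continuous on a compact interval, hence stay in a common ball,
  where each vector field is Lipschitz. Since \<open>u\<close> is bounded there too, one constant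
  serves the whole right-hand side at all times.\<close>

lemma control_affine_solution_unique:
  fixes f\<^sub>0 :: "'a::euclidean_space \<Rightarrow> 'a"
  assumes f0: "smooth f\<^sub>0" and f: "\<And>i. smooth (f i)" and u: "continuous_on {a..b} u"
    and x: "solves_ode_on (control_affine f\<^sub>0 f u) {a..b} x"
    and y: "solves_ode_on (control_affine f\<^sub>0 f u) {a..b} y"
    and init: "x a = y a" and s: "s \<in> {a..b}"
  shows "x s = y s"
proof -
  have bounded_Icc: "\<exists>R. \<forall>s\<in>{a..b}. norm (g s) \<le> R" if "continuous_on {a..b} g"
    for g :: "real \<Rightarrow> 'c::real_normed_vector"
    using compact_imp_bounded[OF compact_continuous_image[OF that compact_Icc]]
    by (simp add: bounded_iff)
  obtain R1 where R1: "\<And>s. s \<in> {a..b} \<Longrightarrow> norm (x s) \<le> R1"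
    using bounded_Icc[OF solves_ode_on_imp_continuous_on[OF x]] by blast
  obtain R2 where R2: "\<And>s. s \<in> {a..b} \<Longrightarrow> norm (y s) \<le> R2"
    using bounded_Icc[OF solves_ode_on_imp_continuous_on[OF y]] by blast
  obtain U where U: "\<And>s. s \<in> {a..b} \<Longrightarrow> norm (u s) \<le> U"
    using bounded_Icc[OF u] by blast
  define R where "R = max R1 R2"
  have xR: "x s \<in> cball 0 R" and yR: "y s \<in> cball 0 R" if "s \<in> {a..b}" for s
    using R1[OF that] R2[OF that] by (auto simp: R_def)
  obtain L0 where L0: "\<And>p q. p \<in> cball 0 R \<Longrightarrow> q \<in> cball 0 R \<Longrightarrow>
      norm (f\<^sub>0 p - f\<^sub>0 q) \<le> L0 * norm (p - q)"
    using smooth_imp_lipschitz_on_cball[OF f0] by blast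
  have "\<exists>L. \<forall>p\<in>cball 0 R. \<forall>q\<in>cball 0 R. norm (f i p - f i q) \<le> L * norm (p - q)" for i
    using smooth_imp_lipschitz_on_cball[OF f[of i], of R] by metis
  then obtain L where L: "\<And>i p q. p \<in> cball 0 R \<Longrightarrow> q \<in> cball 0 R \<Longrightarrow>
      norm (f i p - f i q) \<le> L i * norm (p - q)"
    by metis
  show ?thesis
  proof (rule solves_ode_on_unique[OF x y init _ s])
    fix s assume s: "s \<in> {a..b}"
    have "norm (control_affine f\<^sub>0 f u s (x s) - control_affine f\<^sub>0 f u s (y s))
        = norm ((f\<^sub>0 (x s) - f\<^sub>0 (y s)) + (\<Sum>i\<in>UNIV. u s $ i *\<^sub>R (f i (x s) - f i (y s))))"
      by (simp add: control_affine_def add_diff_add sum_subtractf scaleR_diff_right)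
    also have "\<dots> \<le> norm (f\<^sub>0 (x s) - f\<^sub>0 (y s))
        + (\<Sum>i\<in>UNIV. \<bar>u s $ i\<bar> * norm (f i (x s) - f i (y s)))"
      by (intro norm_triangle_le add_left_mono order_trans[OF norm_sum]) simp
    also have "\<dots> \<le> L0 * norm (x s - y s) + (\<Sum>i\<in>UNIV. U * (L i * norm (x s - y s)))"
      \<comment> \<open>\<open>U\<close> bounds every component of the input, and it is nonnegative
        because it bounds a norm; the product estimate uses both.\<close>
      using order_trans[OF component_le_norm_cart U[OF s]] order_trans[OF norm_ge_zero U[OF s]]
      by (intro add_mono sum_mono mult_mono L0 L xR yR s) auto
    also have "\<dots> = (L0 + (\<Sum>i\<in>UNIV. U * L i)) * norm (x s - y s)"
      by (simp add: algebra_simps sum_distrib_left)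
    finally show "norm (control_affine f\<^sub>0 f u s (x s) - control_affine f\<^sub>0 f u s (y s))
        \<le> (L0 + (\<Sum>i\<in>UNIV. U * L i)) * norm (x s - y s)" .
  qed
qed

section \<open>Outputs, indistinguishable pairs and weak unobservability\<close>

lemma control_affine_output_unique:
  fixes f\<^sub>0 :: "'a::euclidean_space \<Rightarrow> 'a"
  assumes "smooth f\<^sub>0" and "\<And>i. smooth (f i)" and "continuous_on UNIV u"
    and y: "produces_output (control_affine f\<^sub>0 f u) h t0 T p y"
    and z: "produces_output (control_affine f\<^sub>0 f u) h t0 T p z"
    and t: "t \<in> {t0..t0 + T}"
  shows "y t = z t"
proof -
  obtain \<xi> \<tau> where p: "p = (\<xi>, \<tau>)"
    by force
  obtain x where x: "solves_ode_on (control_affine f\<^sub>0 f u) {t0 + \<tau>..t0 + T + \<tau>} x"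
      "x (t0 + \<tau>) = \<xi>" "y t = h (x (t + \<tau>))"
    using y t unfolding produces_output_def p by auto
  obtain x' where x': "solves_ode_on (control_affine f\<^sub>0 f u) {t0 + \<tau>..t0 + T + \<tau>} x'"
      "x' (t0 + \<tau>) = \<xi>" "z t = h (x' (t + \<tau>))"
    using z t unfolding produces_output_def p by auto
  have "x (t + \<tau>) = x' (t + \<tau>)"
    by (rule control_affine_solution_unique[OF assms(1,2) _ x(1) x'(1)])
      (use t x x' continuous_on_subset[OF assms(3)] in auto)
  then show ?thesis
    using x x' by simp
qed

text \<open>Uniqueness of outputs removes the universal quantifier from
  \<open>indistinguishable\<close>: it suffices to exhibit a single output common to both
  pairs.\<close>

lemma control_affine_indistinguishableI:
  fixes f\<^sub>0 :: "'a::euclidean_space \<Rightarrow> 'a"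
  assumes "smooth f\<^sub>0" and "\<And>i. smooth (f i)" and "continuous_on UNIV u"
    and "produces_output (control_affine f\<^sub>0 f u) h t0 T p y"
    and "produces_output (control_affine f\<^sub>0 f u) h t0 T q y"
  shows "indistinguishable (control_affine f\<^sub>0 f u) h t0 T p q"
proof -
  note unique = control_affine_output_unique[where f = f, OF assms(1-3)]
  show ?thesis
    unfolding indistinguishable_def
  proof (intro conjI exI[of _ y] allI impI ballI assms(4,5))
    fix v w t
    assume "produces_output (control_affine f\<^sub>0 f u) h t0 T p v"
      and "produces_output (control_affine f\<^sub>0 f u) h t0 T q w" and "t \<in> {t0..t0 + T}"
    then show "v t = w t"
      using unique[OF _ assms(4)] unique[OF _ assms(5)] by simp
  qed
qed

text \<open>Translating a solution of an autonomous equation in time gives a solution, and the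
  translation by \<open>\<tau> - \<tau>'\<close> makes up for the change of offset.\<close>

lemma produces_output_shift:
  assumes autonomous: "\<And>s s'. F s = F s'"
    and "produces_output F h t0 T (\<xi>, \<tau>) y"
  shows "produces_output F h t0 T (\<xi>, \<tau>') y"
proof -
  obtain x where x: "solves_ode_on F {t0 + \<tau>..t0 + T + \<tau>} x" "x (t0 + \<tau>) = \<xi>"
      "\<forall>t\<in>{t0..t0 + T}. y t = h (x (t + \<tau>))"
    using assms(2) unfolding produces_output_def by auto
  let ?g = "\<lambda>s. s + (\<tau> - \<tau>')"
  have "solves_ode_on F {t0 + \<tau>'..t0 + T + \<tau>'} (x \<circ> ?g)"
    unfolding solves_ode_on_def
  proof
    fix s assume s: "s \<in> {t0 + \<tau>'..t0 + T + \<tau>'}"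
    have img: "?g ` {t0 + \<tau>'..t0 + T + \<tau>'} = {t0 + \<tau>..t0 + T + \<tau>}"
      unfolding image_add_atLeastAtMost' by simp
    have "(x has_vector_derivative F (?g s) (x (?g s))) (at (?g s) within {t0 + \<tau>..t0 + T + \<tau>})"
      using x(1) s unfolding solves_ode_on_def by auto
    moreover have "(?g has_vector_derivative 1) (at s within {t0 + \<tau>'..t0 + T + \<tau>'})"
      by (auto intro!: derivative_eq_intros)
    ultimately show "((x \<circ> ?g) has_vector_derivative F s ((x \<circ> ?g) s))
        (at s within {t0 + \<tau>'..t0 + T + \<tau>'})"
      using vector_diff_chain_within[of ?g 1 s "{t0 + \<tau>'..t0 + T + \<tau>'}" x]
      by (simp add: img add.assoc autonomous[of "?g s" s])
  qed
  then show ?thesis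
    unfolding produces_output_def using x by (auto intro!: exI[of _ "x \<circ> ?g"])
qed

text \<open>A curve of pairs, parametrised by the offset and tending to \<open>(\<xi>, td)\<close>,
  enters every neighborhood. The punctured filter \<open>at td\<close> keeps its offsets different
  from \<open>td\<close>.\<close>

lemma offset_weakly_unobservableI:
  assumes "(g \<longlongrightarrow> \<xi>) (at td)"
    and "\<forall>\<^sub>F \<tau> in at td. indistinguishable F h t0 T (g \<tau>, \<tau>) (\<xi>, td)"
  shows "offset_weakly_unobservable F h t0 T \<xi> td"
  unfolding offset_weakly_unobservable_def offset_weakly_observable_def
proof clarify
  fix N assume N: "open N" "(\<xi>, td) \<in> N"
    and none: "\<forall>\<xi>' td'. (\<xi>', td') \<in> N \<and> td' \<noteq> td \<longrightarrow>
      \<not> indistinguishable F h t0 T (\<xi>', td') (\<xi>, td)"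
  have "((\<lambda>\<tau>. (g \<tau>, \<tau>)) \<longlongrightarrow> (\<xi>, td)) (at td)"
    by (intro tendsto_Pair assms(1) tendsto_ident_at)
  from topological_tendstoD[OF this N] assms(2) eventually_neq_at_within[of td td UNIV]
  \<comment> \<open>This is absurd because \<open>td\<close> is not an isolated point of the real
    line.\<close>
  have "\<forall>\<^sub>F \<tau> in at td. False"
    by eventually_elim (use none in blast)
  then show False
    by simp
qed

theorem theorem1:
  fixes f\<^sub>0 :: "real ^ 'n \<Rightarrow> real ^ 'n"
    and f :: "'m::finite \<Rightarrow> real ^ 'n \<Rightarrow> real ^ 'n"
    and u :: "real \<Rightarrow> real ^ 'm"
    and h :: "real ^ 'n \<Rightarrow> real ^ 'p"
    and t0 T td :: real
    and \<xi> :: "real ^ 'n"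
  assumes "smooth f\<^sub>0" and "\<And>i. smooth (f i)" and "smooth h" and "smooth u"
    and "T > 0"
    and "\<exists>y. produces_output (control_affine f\<^sub>0 f u) h t0 T (\<xi>, td) y"
    and "u constant_on UNIV \<or> constant_observations (control_affine f\<^sub>0 f u) h t0 T \<xi> td"
  shows "offset_weakly_unobservable (control_affine f\<^sub>0 f u) h t0 T \<xi> td"
proof -
  let ?F = "control_affine f\<^sub>0 f u"
  have "Ck 0 u"
    using \<open>smooth u\<close> by (simp only: smooth_def)
  then have u: "continuous_on UNIV u"
    by simp
  note indistinguishableI = control_affine_indistinguishableI[where f = f, OF assms(1,2) u]
  from assms(7) show ?thesis
  proof
    assume "u constant_on UNIV"
    then have autonomous: "?F s = ?F s'" for s s'
      by (auto simp: constant_on_def control_affine_def fun_eq_iff)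
    obtain y where y: "produces_output ?F h t0 T (\<xi>, td) y"
      using assms(6) by blast
    have "indistinguishable ?F h t0 T (\<xi>, \<tau>) (\<xi>, td)" for \<tau>
      by (rule indistinguishableI[OF produces_output_shift[OF autonomous y] y])
    then show ?thesis
      by (intro offset_weakly_unobservableI[of "\<lambda>_. \<xi>"]) auto
  next
    assume "constant_observations ?F h t0 T \<xi> td"
    then obtain J x where J: "open J" "is_interval J" "{t0..t0 + T} \<subseteq> J"
      and x: "solves_ode_on ?F ((\<lambda>t. t + td) ` J) x" "x (t0 + td) = \<xi>"
      and const: "(\<lambda>t. h (x (t + td))) constant_on J"
      unfolding constant_observations_def by blast
    from const obtain c where c: "\<And>t. t \<in> J \<Longrightarrow> h (x (t + td)) = c"
      unfolding constant_on_def by blast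
    \<comment> \<open>With offset \<open>\<tau>\<close> the trajectory \<open>x\<close> is observed
      at \<open>t + \<tau>\<close>, which corresponds to the time \<open>t + \<tau> - td\<close> of
      the constant observation. As \<open>J\<close> is an interval, only the two ends of the shifted
      window have to be checked.\<close>
    have const_output: "produces_output ?F h t0 T (x (t0 + \<tau>), \<tau>) (\<lambda>_. c)"
      if lo: "t0 + \<tau> - td \<in> J" and hi: "t0 + T + \<tau> - td \<in> J" for \<tau>
    proof -
      have in_J: "s - td \<in> J" if "s \<in> {t0 + \<tau>..t0 + T + \<tau>}" for s
        by (rule mem_is_interval_1_I[OF J(2) lo hi]) (use that in auto)
      then have "{t0 + \<tau>..t0 + T + \<tau>} \<subseteq> (\<lambda>t. t + td) ` J"
        by (metis diff_add_cancel imageI subsetI)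
      then have "solves_ode_on ?F {t0 + \<tau>..t0 + T + \<tau>} x"
        using x(1) unfolding solves_ode_on_def
        by (meson has_vector_derivative_within_subset subsetD)
      moreover have "h (x (t + \<tau>)) = c" if "t \<in> {t0..t0 + T}" for t
        using c[OF in_J[of "t + \<tau>"]] that by simp
      ultimately show ?thesis
        unfolding produces_output_def by auto
    qed
    have ends: "t0 \<in> J" "t0 + T \<in> J"
      using J(3) \<open>T > 0\<close> by auto
    \<comment> \<open>Openness of \<open>J\<close> leaves room to shift the window slightly in
      either direction.\<close>
    have "((\<lambda>\<tau>. t0 + \<tau> - td) \<longlongrightarrow> t0) (at td)" "((\<lambda>\<tau>. t0 + T + \<tau> - td) \<longlongrightarrow> t0 + T) (at td)"
      by (auto intro!: tendsto_eq_intros)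
    from this[THEN topological_tendstoD[OF _ J(1)]] ends
    have "\<forall>\<^sub>F \<tau> in at td. t0 + \<tau> - td \<in> J" "\<forall>\<^sub>F \<tau> in at td. t0 + T + \<tau> - td \<in> J"
      by auto
    then have "\<forall>\<^sub>F \<tau> in at td. indistinguishable ?F h t0 T (x (t0 + \<tau>), \<tau>) (\<xi>, td)"
    proof eventually_elim
      case (elim \<tau>)
      have "produces_output ?F h t0 T (\<xi>, td) (\<lambda>_. c)"
        using const_output[of td] ends x(2) by simp
      then show ?case
        using const_output[OF elim] indistinguishableI by blast
    qed
    moreover have "((\<lambda>\<tau>. x (t0 + \<tau>)) \<longlongrightarrow> \<xi>) (at td)"
    proof -
      \<comment> \<open>On an open time domain, continuity of \<open>x\<close> within the domain is
        continuity at the point, so the states \<open>x (t0 + \<tau>)\<close> approach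
        \<open>\<xi>\<close> from both sides.\<close>
      have "open ((\<lambda>t. t + td) ` J)"
        using open_translation[OF J(1), of td] by (simp add: add.commute)
      then have "isCont x (t0 + td)"
        using solves_ode_on_imp_continuous_on[OF x(1)] ends
        by (auto simp: continuous_on_eq_continuous_at)
      then show ?thesis
        unfolding x(2)[symmetric] by (rule isCont_tendsto_compose) (intro tendsto_intros)
    qed
    ultimately show ?thesis
      by (intro offset_weakly_unobservableI)
  qed
qed

end
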